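(* Let $n\ge 1$ be an integer. If the $4n$ vertices of the graph $K_{1,3}\times P_n$ are colored uniformly and independently with two colors, the expected number of blocks is $$\mathbb{E}[X_2(K_{1,3}\times P_n)]=\frac{2254219}{1411200}+\frac{6}{49}2^{-3n}-\frac{2}{225}2^{-4n}+\frac{11933}{13440}n.$$
   Context: $K_{1,3}$ is the star graph (complete bipartite graph with parts of sizes $1$ and $3$) and $P_n$ the path graph on $n$ vertices. The product $G_1\times G_2$ of graphs $G_1=(V_1,E_1)$, $G_2=(V_2,E_2)$ is the Cartesian product: its vertex set is $V_1\times V_2$, and $(v_1,v_2),(w_1,w_2)$ are adjacent iff ($v_1=w_1$ and $\{v_2,w_2\}\in E_2$) or ($v_2=w_2$ and $\{v_1,w_1\}\in E_1$). Given a coloring of the vertices of a finite graph $G$ with $k$ colors, the blocks are the connected components of the subgraph of $G$ formed by all vertices and all edges whose two endpoints have the same color. $X_k(G)$ denotes the number of blocks when each vertex of $G$ receives independently a uniformly random color among $k$ colors. *)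

theory Defs
  imports "HOL-Probability.Probability" "HOL-Probability.Product_PMF"
begin

record 'v ugraph =
  vertices :: "'v set"
  edges :: "'v set set"

definition path_graph :: "nat \<Rightarrow> nat ugraph" where
  "path_graph n = \<lparr>vertices = {..<n}, edges = {{i, Suc i} | i. Suc i < n}\<rparr>"

definition complete_bipartite :: "nat \<Rightarrow> nat \<Rightarrow> (nat + nat) ugraph" where
  "complete_bipartite a b =
     \<lparr>vertices = Inl ` {..<a} \<union> Inr ` {..<b},
      edges = {{Inl i, Inr j} | i j. i < a \<and> j < b}\<rparr>"

definition cartesian_product :: "'a ugraph \<Rightarrow> 'b ugraph \<Rightarrow> ('a \<times> 'b) ugraph" where
  "cartesian_product G H =
     \<lparr>vertices = vertices G \<times> vertices H,
      edges = {{(v1, v2), (w1, w2)} | v1 v2 w1 w2.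
        (v1, v2) \<in> vertices G \<times> vertices H \<and> (w1, w2) \<in> vertices G \<times> vertices H \<and>
        (v1 = w1 \<and> {v2, w2} \<in> edges H \<or> v2 = w2 \<and> {v1, w1} \<in> edges G)}\<rparr>"

text \<open>Connected components, given by their vertex sets.\<close>

definition connected_rel :: "'v ugraph \<Rightarrow> ('v \<times> 'v) set" where
  "connected_rel G =
     {(u, v). u \<in> vertices G \<and> v \<in> vertices G \<and> (u, v) \<in> {(x, y). {x, y} \<in> edges G}\<^sup>*}"

definition components :: "'v ugraph \<Rightarrow> 'v set set" where
  "components G = vertices G // connected_rel G"

lemma equiv_connected_rel: "equiv (vertices G) (connected_rel G)"
proof -
  have "sym ({(x, y). {x, y} \<in> edges G}\<^sup>*)"
    by (intro sym_rtrancl symI) (simp add: insert_commute)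
  then have "sym (connected_rel G)"
    unfolding connected_rel_def sym_def by blast
  moreover have "trans (connected_rel G)"
    unfolding connected_rel_def trans_def by (blast intro: rtrancl_trans)
  moreover have "refl_on (vertices G) (connected_rel G)"
    unfolding connected_rel_def refl_on_def by blast
  moreover have "connected_rel G \<subseteq> vertices G \<times> vertices G"
    unfolding connected_rel_def by blast
  ultimately show ?thesis
    by (simp add: equiv_def)
qed

definition monochromatic_subgraph :: "'v ugraph \<Rightarrow> ('v \<Rightarrow> 'c) \<Rightarrow> 'v ugraph" where
  "monochromatic_subgraph G c =
     \<lparr>vertices = vertices G, edges = {e \<in> edges G. \<forall>u\<in>e. \<forall>v\<in>e. c u = c v}\<rparr>"

definition blocks :: "'v ugraph \<Rightarrow> ('v \<Rightarrow> 'c) \<Rightarrow> 'v set set" where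
  "blocks G c = components (monochromatic_subgraph G c)"

text \<open>The value \<open>undefined\<close> is only the default outside \<open>vertices G\<close>, where it does not matter.\<close>

definition random_coloring :: "nat \<Rightarrow> 'v ugraph \<Rightarrow> ('v \<Rightarrow> nat) pmf" where
  "random_coloring k G = Pi_pmf (vertices G) undefined (\<lambda>_. pmf_of_set {..<k})"

definition block_count :: "nat \<Rightarrow> 'v ugraph \<Rightarrow> nat pmf" where
  "block_count k G = map_pmf (\<lambda>c. card (blocks G c)) (random_coloring k G)"

end

theory Submission
  imports Defs
begin

text \<open>
  Build the graph column by column, adding in each column first the three leaves and then the centre.
  A leaf has at most one earlier neighbour. When the centre of column \<open>t\<close> is added, the number of blocks
  it merges is determined by which leaves of column \<open>t\<close> are already connected, and two leaves of
  colour \<open>x\<close> are connected through earlier columns iff, going back from \<open>t\<close>, both keep colour \<open>x\<close>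
  until the last earlier column \<open>s\<close> whose centre has colour \<open>x\<close>. Hence the number of blocks is

    vertices - monochromatic edges + monochromatic unit squares + pair holes - triple holes,

  where a hole is a pair of columns \<open>s + 1 < t\<close> as above, closed by a centre of colour \<open>x\<close> in column \<open>t\<close>,
  counted for every pair of leaves and for the triple. A hole with \<open>k\<close> leaves
  has probability \<open>2 * 2 ^ (- (k + 1) (t - s + 1))\<close>; summing over \<open>s\<close> and \<open>t\<close> gives the terms in
  \<open>8 ^ (- n)\<close> and \<open>16 ^ (- n)\<close>.
\<close>

section \<open>Components of induced subgraphs\<close>

text \<open>The relation \<open>E\<close> stays fixed while the vertex set grows, so one adjacency
  relation serves every stage of the construction. Membership in \<open>V\<close> is demanded of
  both ends because the reflexive closure alone would relate outside vertices to themselves.\<close>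

definition induced_conn :: "('v \<times> 'v) set \<Rightarrow> 'v set \<Rightarrow> ('v \<times> 'v) set" where
  "induced_conn E V = {(u, v). u \<in> V \<and> v \<in> V \<and> (u, v) \<in> (E \<inter> V \<times> V)\<^sup>*}"

definition component_count :: "('v \<times> 'v) set \<Rightarrow> 'v set \<Rightarrow> nat" where
  "component_count E V = card (V // induced_conn E V)"

lemma equiv_induced_conn:
  assumes "sym E"
  shows "equiv V (induced_conn E V)"
proof -
  have "sym (E \<inter> V \<times> V)"
    using assms by (auto simp: sym_def)
  then have "sym ((E \<inter> V \<times> V)\<^sup>*)"
    by (rule sym_rtrancl)
  then have "sym (induced_conn E V)"
    unfolding induced_conn_def sym_def by blast
  moreover have "trans (induced_conn E V)"
    unfolding induced_conn_def trans_def by (blast intro: rtrancl_trans)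
  moreover have "refl_on V (induced_conn E V)" "induced_conn E V \<subseteq> V \<times> V"
    unfolding induced_conn_def refl_on_def by blast+
  ultimately show ?thesis
    by (simp add: equiv_def)
qed

lemma induced_conn_refl: "u \<in> V \<Longrightarrow> (u, u) \<in> induced_conn E V"
  by (simp add: induced_conn_def)

lemma induced_conn_edge:
  "(u, v) \<in> E \<Longrightarrow> u \<in> V \<Longrightarrow> v \<in> V \<Longrightarrow> (u, v) \<in> induced_conn E V"
  by (auto simp: induced_conn_def)

lemma induced_conn_in: "(u, v) \<in> induced_conn E V \<Longrightarrow> u \<in> V \<and> v \<in> V"
  by (simp add: induced_conn_def)

lemma induced_conn_trans:
  "(u, v) \<in> induced_conn E V \<Longrightarrow> (v, w) \<in> induced_conn E V \<Longrightarrow> (u, w) \<in> induced_conn E V"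
  by (auto simp: induced_conn_def)

lemma induced_conn_sym:
  "sym E \<Longrightarrow> (u, v) \<in> induced_conn E V \<Longrightarrow> (v, u) \<in> induced_conn E V"
  using equiv_induced_conn[of E V] by (auto simp: equiv_def sym_def)

lemma induced_conn_mono:
  "V \<subseteq> W \<Longrightarrow> induced_conn E V \<subseteq> induced_conn E W"
  unfolding induced_conn_def using rtrancl_mono[of "E \<inter> V \<times> V" "E \<inter> W \<times> W"] by auto

text \<open>Induction along a path with its start fixed: an upper bound \<open>R\<close> only has to
  survive appending one edge.\<close>

lemma induced_conn_least:
  assumes "\<And>u. u \<in> V \<Longrightarrow> (u, u) \<in> R"
    and "\<And>u v w. (u, v) \<in> R \<Longrightarrow> (v, w) \<in> E \<Longrightarrow> v \<in> V \<Longrightarrow> w \<in> V \<Longrightarrow> (u, w) \<in> R"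
  shows "induced_conn E V \<subseteq> R"
proof clarify
  fix u v assume "(u, v) \<in> induced_conn E V"
  then have "u \<in> V" "(u, v) \<in> (E \<inter> V \<times> V)\<^sup>*"
    by (auto simp: induced_conn_def)
  from this(2) show "(u, v) \<in> R"
    by induction (use assms \<open>u \<in> V\<close> in blast)+
qed

section \<open>Adding one vertex\<close>

text \<open>\<open>T\<close> is the component of the new vertex \<open>v\<close>: it swallows every
  old component containing a neighbour of \<open>v\<close>, and all other components stay as they
  are.\<close>

lemma induced_conn_insert:
  assumes "sym E" "v \<notin> V"
  defines "T \<equiv> insert v {u. \<exists>w\<in>V. (v, w) \<in> E \<and> (u, w) \<in> induced_conn E V}"
  shows "induced_conn E (insert v V) = induced_conn E V \<union> T \<times> T" (is "?L = ?R")
proof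
  have step: "(u, y) \<in> ?R" if "(u, x) \<in> ?R" "(x, y) \<in> E" "x \<in> insert v V" "y \<in> insert v V" for u x y
  proof -
    have cyx: "(y, x) \<in> E"
      using that(2) assms(1) by (auto simp: sym_def)
    \<comment> \<open>No edge inside the enlarged vertex set leaves \<open>T\<close>; this is what
      makes the right-hand side closed under appending an edge.\<close>
    have tv: "x \<in> T \<longleftrightarrow> y \<in> T"
    proof (cases "x = v \<or> y = v")
      case True
      then show ?thesis
        using that cyx by (auto simp: T_def intro: induced_conn_refl)
    next
      case False
      then have "(x, y) \<in> induced_conn E V" "(y, x) \<in> induced_conn E V"
        using that cyx by (auto intro: induced_conn_edge)
      then show ?thesis
        using False by (auto simp: T_def intro: induced_conn_trans)
    qed
    show ?thesis
    proof (cases "(u, x) \<in> T \<times> T")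
      case True
      then show ?thesis using tv by auto
    next
      case False
      then have ux: "(u, x) \<in> induced_conn E V"
        using that(1) by auto
      show ?thesis
      proof (cases "y = v")
        case True
        then have "x \<in> T"
          using tv by (simp add: T_def)
        then have "u \<in> T"
          using ux assms(2) induced_conn_in[OF ux] unfolding T_def
          by (auto intro: induced_conn_trans)
        moreover have "v \<in> T" by (simp add: T_def)
        ultimately show ?thesis
          using True by blast
      next
        case False
        then have "(x, y) \<in> induced_conn E V"
          using that induced_conn_in[OF ux] by (auto intro: induced_conn_edge)
        then show ?thesis
          using ux by (auto intro: induced_conn_trans)
      qed
    qed
  qed
  show "?L \<subseteq> ?R"
  proof (rule induced_conn_least)
    show "(u, u) \<in> ?R" if "u \<in> insert v V" for u
      using that by (auto simp: T_def intro: induced_conn_refl)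
  qed (rule step)
  have old: "induced_conn E V \<subseteq> ?L"
    by (rule induced_conn_mono) auto
  have "(v, u) \<in> ?L" if uT: "u \<in> T" for u
  proof (cases "u = v")
    case True
    then show ?thesis by (simp add: induced_conn_refl)
  next
    case False
    then obtain w where w: "w \<in> V" "(v, w) \<in> E" "(u, w) \<in> induced_conn E V"
      using uT by (auto simp: T_def)
    then have "(v, w) \<in> ?L"
      by (auto intro: induced_conn_edge)
    moreover have "(w, u) \<in> ?L"
      using w old induced_conn_sym[OF assms(1)] by blast
    ultimately show ?thesis
      by (rule induced_conn_trans)
  qed
  then have "T \<times> T \<subseteq> ?L"
    by (auto intro: induced_conn_trans induced_conn_sym[OF assms(1)])
  with old show "?R \<subseteq> ?L" by blast
qed

text \<open>The old components that meet the neighbourhood \<open>N\<close> of \<open>v\<close> are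
  replaced by a single one. The identity is written additively to avoid subtraction of natural
  numbers.\<close>

lemma component_count_insert:
  assumes "sym E" "v \<notin> V" "finite V"
  defines "N \<equiv> {w \<in> V. (v, w) \<in> E}"
  shows "component_count E (insert v V) + card ((\<lambda>w. induced_conn E V `` {w}) ` N)
    = component_count E V + 1"
proof -
  let ?r = "induced_conn E V"
  let ?r' = "induced_conn E (insert v V)"
  define T where "T = insert v {u. \<exists>w\<in>V. (v, w) \<in> E \<and> (u, w) \<in> ?r}"
  define Q where "Q = (\<lambda>w. ?r `` {w}) ` N"
  have r': "?r' = ?r \<union> T \<times> T"
    unfolding T_def by (rule induced_conn_insert) fact+
  have eq: "equiv V ?r"
    by (rule equiv_induced_conn) fact
  \<comment> \<open>On old vertices, membership in \<open>T\<close> depends only on the old class,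
    and the classes inside \<open>T\<close> are those of neighbours of \<open>v\<close>.\<close>
  have Q_iff: "?r `` {u} \<in> Q \<longleftrightarrow> u \<in> T" if "u \<in> V" for u
  proof
    assume "?r `` {u} \<in> Q"
    then obtain w where w: "w \<in> N" "?r `` {u} = ?r `` {w}"
      by (auto simp: Q_def)
    then have "(u, w) \<in> ?r"
      using eq_equiv_class[OF w(2) eq] by (auto simp: N_def)
    then show "u \<in> T"
      using w by (auto simp: T_def N_def)
  next
    assume "u \<in> T"
    then obtain w where "w \<in> N" "(u, w) \<in> ?r"
      using \<open>u \<in> V\<close> assms(2) by (auto simp: T_def N_def)
    then show "?r `` {u} \<in> Q"
      using equiv_class_eq[OF eq] by (auto simp: Q_def)
  qed
  have cT: "?r' `` {u} = T" if "u \<in> T" for u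
  proof -
    have "?r `` {u} \<subseteq> T"
    proof
      fix w assume w: "w \<in> ?r `` {u}"
      then have "u \<in> V" "w \<in> V" and "(u, w) \<in> ?r"
        using induced_conn_in[of u w E V] by auto
      then have "?r `` {w} = ?r `` {u}"
        using equiv_class_eq[OF eq] by auto
      then show "w \<in> T"
        using Q_iff \<open>u \<in> V\<close> \<open>w \<in> V\<close> that by metis
    qed
    then show ?thesis
      using that by (auto simp: r')
  qed
  have cV: "?r' `` {u} = ?r `` {u}" if "u \<notin> T" for u
    using that by (auto simp: r')
  have "insert v V // ?r' = insert T (V // ?r - Q)"
  proof (intro equalityI subsetI)
    fix X assume "X \<in> insert v V // ?r'"
    then obtain u where u: "u \<in> insert v V" "X = ?r' `` {u}"
      by (auto simp: quotient_def)
    show "X \<in> insert T (V // ?r - Q)"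
    proof (cases "u \<in> T")
      case True
      then show ?thesis using u cT by simp
    next
      case False
      then have "u \<in> V" using u by (auto simp: T_def)
      then show ?thesis
        using False u cV Q_iff by (auto simp: quotient_def)
    qed
  next
    fix X assume "X \<in> insert T (V // ?r - Q)"
    then consider "X = T" | "X \<in> V // ?r" "X \<notin> Q" by blast
    then show "X \<in> insert v V // ?r'"
    proof cases
      case 1
      have "v \<in> T" by (simp add: T_def)
      then show ?thesis
        using 1 cT[of v] by (auto simp: quotient_def)
    next
      case 2
      then obtain u where u: "u \<in> V" "X = ?r `` {u}" "u \<notin> T"
        using Q_iff by (auto simp: quotient_def)
      then have "X = ?r' `` {u}"
        using cV by simp
      then show ?thesis
        using u(1) quotientI[of u "insert v V" ?r'] by simp
    qed
  qed
  moreover have fin: "finite (V // ?r)"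
    using assms(3) by (auto simp: quotient_def)
  \<comment> \<open>The merged class contains \<open>v\<close>, so inserting it really raises the
    cardinality by one.\<close>
  moreover have "T \<notin> V // ?r"
  proof
    assume "T \<in> V // ?r"
    then have "T \<subseteq> V"
      by (auto simp: quotient_def dest: induced_conn_in)
    then show False using assms(2) by (auto simp: T_def)
  qed
  moreover have sub: "Q \<subseteq> V // ?r"
    by (auto simp: Q_def N_def quotient_def)
  moreover have "card (V // ?r - Q) = card (V // ?r) - card Q"
    using sub fin by (simp add: card_Diff_subset finite_subset)
  moreover have "card Q \<le> card (V // ?r)"
    using sub fin by (simp add: card_mono)
  ultimately show ?thesis
    by (simp add: component_count_def Q_def)
qed

section \<open>Adding independent vertices with at most one old neighbour each\<close>

text \<open>A path that enters a vertex of \<open>L\<close> from \<open>V\<close> can only go back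
  along the same edge, so new vertices create no connection within \<open>V\<close>.
  \<open>P\<close> sends an old vertex to itself and a new one to its neighbour;
  \<open>Id_on L\<close> supplies the trivial paths at new vertices without a neighbour.\<close>

lemma induced_conn_pendant:
  assumes "sym E" "V \<inter> L = {}"
    and indep: "\<And>l l'. l \<in> L \<Longrightarrow> l' \<in> L \<Longrightarrow> (l, l') \<notin> E"
    and unique: "\<And>l w w'. l \<in> L \<Longrightarrow> w \<in> V \<Longrightarrow> w' \<in> V \<Longrightarrow> (l, w) \<in> E \<Longrightarrow> (l, w') \<in> E \<Longrightarrow> w = w'"
  defines "P \<equiv> Id_on V \<union> E \<inter> L \<times> V"
  shows "induced_conn E (V \<union> L) = Id_on L \<union> P O induced_conn E V O P\<inverse>" (is "?L = ?R")
proof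
  show "?L \<subseteq> ?R"
  proof (rule induced_conn_least)
    show "(u, u) \<in> ?R" if "u \<in> V \<union> L" for u
    proof -
      have "(u, u) \<in> P O induced_conn E V O P\<inverse>" if "u \<in> V"
        using that induced_conn_refl[of u V E] by (auto simp: P_def)
      then show ?thesis
        using that by auto
    qed
    show "(u, y) \<in> ?R" if ux: "(u, x) \<in> ?R" and xy: "(x, y) \<in> E" and "x \<in> V \<union> L" "y \<in> V \<union> L" for u x y
    proof -
      have yx: "(y, x) \<in> E"
        using xy assms(1) by (auto simp: sym_def)
      have "x \<in> V \<and> y \<in> V \<or> x \<in> V \<and> y \<in> L \<or> x \<in> L \<and> y \<in> V"
        using that indep by blast
      then consider "x \<in> V" "y \<in> V" | "x \<in> V" "y \<in> L" | "x \<in> L" "y \<in> V"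
        by blast
      then show ?thesis
      proof cases
        case 1
        then obtain u' where u': "(u, u') \<in> P" "(u', x) \<in> induced_conn E V"
          using ux assms(2) by (auto simp: P_def)
        have "(u', y) \<in> induced_conn E V"
          using u'(2) induced_conn_edge[OF xy] 1 by (blast intro: induced_conn_trans)
        then show ?thesis
          using u'(1) 1 by (auto simp: P_def)
      next
        case 2
        then obtain u' where u': "(u, u') \<in> P" "(u', x) \<in> induced_conn E V"
          using ux assms(2) by (auto simp: P_def)
        moreover have "(y, x) \<in> P"
          using 2 yx by (auto simp: P_def)
        ultimately show ?thesis by auto
      next
        case 3
        \<comment> \<open>The only neighbour of \<open>x\<close> in \<open>V\<close> is
          \<open>y\<close>, so the step from \<open>x\<close> to \<open>y\<close> retraces the edge
          by which a nontrivial path reached \<open>x\<close>.\<close>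
        have xP: "x' = y" if "(x, x') \<in> P" for x'
          using that 3 xy unique assms(2) by (auto simp: P_def)
        have yP: "(y, y) \<in> P" "(x, y) \<in> P"
          using 3 xy by (auto simp: P_def)
        show ?thesis
        proof (cases "u = x")
          case True
          then show ?thesis
            using yP induced_conn_refl[of y V E] 3 by auto
        next
          case False
          then obtain u' where "(u, u') \<in> P" "(u', y) \<in> induced_conn E V"
            using ux xP by auto
          then show ?thesis using yP by auto
        qed
      qed
    qed
  qed
  have P: "(u, u') \<in> ?L" if "(u, u') \<in> P" for u u'
    using that by (auto simp: P_def intro: induced_conn_refl induced_conn_edge)
  have old: "induced_conn E V \<subseteq> ?L"
    by (rule induced_conn_mono) auto
  show "?R \<subseteq> ?L"
  proof (rule subrelI, rule ccontr)
    fix u w assume uw: "(u, w) \<in> ?R" "(u, w) \<notin> ?L"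
    then have "(u, w) \<notin> Id_on L"
      by (auto intro: induced_conn_refl)
    then obtain u' w' where "(u, u') \<in> P" "(u', w') \<in> induced_conn E V" "(w, w') \<in> P"
      using uw(1) by auto
    then have "(u, u') \<in> ?L" "(u', w') \<in> ?L" "(w', w) \<in> ?L"
      using P old induced_conn_sym[OF assms(1)] by blast+
    then show False
      using uw(2) by (blast intro: induced_conn_trans)
  qed
qed

text \<open>Inserting the vertices of \<open>L\<close> one by one, each either joins the component
  of its single neighbour or opens a new component.\<close>

lemma component_count_pendant:
  assumes "sym E" "finite V" "finite L" "V \<inter> L = {}"
    and indep: "\<And>l l'. l \<in> L \<Longrightarrow> l' \<in> L \<Longrightarrow> (l, l') \<notin> E"
    and unique: "\<And>l w w'. l \<in> L \<Longrightarrow> w \<in> V \<Longrightarrow> w' \<in> V \<Longrightarrow> (l, w) \<in> E \<Longrightarrow> (l, w') \<in> E \<Longrightarrow> w = w'"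
  shows "component_count E (V \<union> L) + card {l \<in> L. \<exists>w\<in>V. (l, w) \<in> E} = component_count E V + card L"
  using assms(3-6)
proof (induction L rule: finite_induct)
  case empty
  then show ?case by simp
next
  case (insert l L)
  let ?N = "{w \<in> V \<union> L. (l, w) \<in> E}"
  let ?C = "\<lambda>w. induced_conn E (V \<union> L) `` {w}"
  have IH: "component_count E (V \<union> L) + card {l \<in> L. \<exists>w\<in>V. (l, w) \<in> E} = component_count E V + card L"
    using insert.prems by (intro insert.IH) (auto, blast)
  have "component_count E (insert l (V \<union> L)) + card (?C ` ?N) = component_count E (V \<union> L) + 1"
    using insert assms(1,2) by (intro component_count_insert) auto
  moreover have "card (?C ` ?N) = (if \<exists>w\<in>V. (l, w) \<in> E then 1 else 0)"
  proof (cases "\<exists>w\<in>V. (l, w) \<in> E")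
    case True
    then obtain w where w: "w \<in> V" "(l, w) \<in> E" by blast
    have "x = w" if "x \<in> ?N" for x
      using that w insert.prems(2)[of l x] insert.prems(3)[of l x w] by blast
    then have "?N = {w}"
      using w by blast
    then have "?C ` ?N = {?C w}" by (simp only: image_insert image_empty)
    then show ?thesis using True by simp
  next
    case False
    then have "?N = {}"
      using insert.prems(2)[of l] by blast
    then show ?thesis using False by (simp only: image_empty card.empty if_False)
  qed
  moreover have "{k \<in> insert l L. \<exists>w\<in>V. (k, w) \<in> E}
    = (if \<exists>w\<in>V. (l, w) \<in> E then insert l {k \<in> L. \<exists>w\<in>V. (k, w) \<in> E} else {k \<in> L. \<exists>w\<in>V. (k, w) \<in> E})"
    by auto
  ultimately show ?case
    using IH insert.hyps by (cases "\<exists>w\<in>V. (l, w) \<in> E") simp_all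
qed

section \<open>The number of blocks of a fixed colouring\<close>

text \<open>The pair \<open>(Inl 0, t)\<close> is the centre and \<open>(Inr i, t)\<close> a leaf of
  column \<open>t\<close>. The relation is unbounded in leaves and columns; the finite graphs arise
  by restricting it to \<open>star_columns m n\<close>.\<close>

definition star_path_adj :: "((nat + nat) \<times> nat) rel" where
  "star_path_adj = {((p, s), (q, t)).
     s = t \<and> (p = Inl 0 \<and> (\<exists>i. q = Inr i) \<or> q = Inl 0 \<and> (\<exists>i. p = Inr i)) \<or>
     p = q \<and> (t = Suc s \<or> s = Suc t)}"

definition mono_adj :: "((nat + nat) \<times> nat \<Rightarrow> 'c) \<Rightarrow> ((nat + nat) \<times> nat) rel" where
  "mono_adj c = {(u, v). (u, v) \<in> star_path_adj \<and> c u = c v}"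

definition star_columns :: "nat \<Rightarrow> nat \<Rightarrow> ((nat + nat) \<times> nat) set" where
  "star_columns m t = (Inl ` {..<1} \<union> Inr ` {..<m}) \<times> {..<t}"

definition leaf_column :: "nat \<Rightarrow> nat \<Rightarrow> ((nat + nat) \<times> nat) set" where
  "leaf_column m t = (\<lambda>i. (Inr i, t)) ` {..<m}"

text \<open>For \<open>s + 1 < t\<close> and two leaves \<open>S\<close>, this says that the boundary of the two-page rectangle between
  columns \<open>s\<close> and \<open>t\<close> is monochromatic while the spine inside it is not part of its block.
  The degenerate cases \<open>hole c {i} t t\<close>, \<open>hole c {} (t - 1) t\<close> and \<open>hole c {i} (t - 1) t\<close>
  are monochromatic horizontal edges, centre edges and unit squares.\<close>

definition hole :: "((nat + nat) \<times> nat \<Rightarrow> 'c) \<Rightarrow> nat set \<Rightarrow> nat \<Rightarrow> nat \<Rightarrow> bool" where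
  "hole c S s t \<longleftrightarrow> c (Inl 0, s) = c (Inl 0, t) \<and>
     (\<forall>r\<in>{s<..<t}. c (Inl 0, r) \<noteq> c (Inl 0, t)) \<and>
     (\<forall>i\<in>S. \<forall>r\<in>{s..t}. c (Inr i, r) = c (Inl 0, t))"

lemma sym_mono_adj: "sym (mono_adj c)"
  by (auto simp: sym_def mono_adj_def star_path_adj_def)

lemma finite_star_columns: "finite (star_columns m t)"
  by (simp add: star_columns_def)

lemma star_columns_Suc:
  "star_columns m (Suc t) = insert (Inl 0, t) (star_columns m t \<union> leaf_column m t)"
  by (auto simp: star_columns_def leaf_column_def less_Suc_eq)

lemma induced_conn_mono_adj_color:
  assumes "(u, v) \<in> induced_conn (mono_adj c) V"
  shows "c u = c v"
proof -
  have "induced_conn (mono_adj c) V \<subseteq> {(u, v). c u = c v}"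
    by (rule induced_conn_least) (auto simp: mono_adj_def)
  then show ?thesis using assms by auto
qed

section \<open>Connections between the leaves of a column\<close>

text \<open>These are the hypotheses of \<open>induced_conn_pendant\<close> for the leaves of a new
  column: before the centre arrives, a leaf can only be adjacent to the same leaf one column
  earlier.\<close>

lemma leaf_column_pendant:
  shows "star_columns m t \<inter> leaf_column m t = {}"
    and "\<And>l l'. l \<in> leaf_column m t \<Longrightarrow> l' \<in> leaf_column m t \<Longrightarrow> (l, l') \<notin> mono_adj c"
    and "\<And>l w w'. l \<in> leaf_column m t \<Longrightarrow> w \<in> star_columns m t \<Longrightarrow> w' \<in> star_columns m t \<Longrightarrow>
      (l, w) \<in> mono_adj c \<Longrightarrow> (l, w') \<in> mono_adj c \<Longrightarrow> w = w'"
  by (auto simp: star_columns_def leaf_column_def mono_adj_def star_path_adj_def)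

lemma induced_conn_columns:
  fixes m t c
  defines "P \<equiv> Id_on (star_columns m t) \<union> mono_adj c \<inter> leaf_column m t \<times> star_columns m t"
  shows "induced_conn (mono_adj c) (star_columns m t \<union> leaf_column m t)
    = Id_on (leaf_column m t) \<union> P O induced_conn (mono_adj c) (star_columns m t) O P\<inverse>"
  unfolding P_def
  by (rule induced_conn_pendant[OF sym_mono_adj]) (simp add: leaf_column_pendant(1), metis leaf_column_pendant(2), metis leaf_column_pendant(3))

text \<open>Without the centre of column \<open>t\<close>, a path between two of its leaves must
  step back along both leaf rows. In column 0 there is nowhere to go, and \<open>t = Suc s\<close>
  fails.\<close>

lemma induced_conn_leaf_column:
  assumes "i < m" "j < m" "i \<noteq> j"
  shows "((Inr i, t), (Inr j, t)) \<in> induced_conn (mono_adj c) (star_columns m t \<union> leaf_column m t) \<longleftrightarrow>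
    (\<exists>s. t = Suc s \<and> c (Inr i, s) = c (Inr i, t) \<and> c (Inr j, s) = c (Inr j, t) \<and>
      ((Inr i, s), (Inr j, s)) \<in> induced_conn (mono_adj c) (star_columns m t))"
proof -
  define P where "P = Id_on (star_columns m t) \<union> mono_adj c \<inter> leaf_column m t \<times> star_columns m t"
  have conn: "induced_conn (mono_adj c) (star_columns m t \<union> leaf_column m t)
    = Id_on (leaf_column m t) \<union> P O induced_conn (mono_adj c) (star_columns m t) O P\<inverse>"
    unfolding P_def by (rule induced_conn_columns)
  have P: "((Inr k, t), w) \<in> P \<longleftrightarrow> (\<exists>s. t = Suc s \<and> w = (Inr k, s) \<and> c (Inr k, s) = c (Inr k, t))" if "k < m" for k w
    using that
    by (auto simp: P_def star_columns_def leaf_column_def mono_adj_def star_path_adj_def)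
  show ?thesis
    using assms(3) by (auto simp: conn relcomp_unfold P[OF assms(1)] P[OF assms(2)])
qed

text \<open>The only way out of the leaf leads through its predecessor in column \<open>s\<close>;
  if that has the right colour, the centre of column \<open>s\<close> is one further edge
  away.\<close>

lemma induced_conn_leaf_centre:
  assumes "i < m"
  shows "((Inr i, Suc s), (Inl 0, s)) \<in> induced_conn (mono_adj c) (star_columns m (Suc s) \<union> leaf_column m (Suc s)) \<longleftrightarrow>
    c (Inr i, Suc s) = c (Inl 0, s) \<and> c (Inr i, s) = c (Inl 0, s)"
    (is "?conn \<longleftrightarrow> ?col")
proof
  assume conn: ?conn
  then have "c (Inr i, Suc s) = c (Inl 0, s)"
    by (rule induced_conn_mono_adj_color)
  moreover obtain w where "((Inr i, Suc s), w) \<in>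
      Id_on (star_columns m (Suc s)) \<union> mono_adj c \<inter> leaf_column m (Suc s) \<times> star_columns m (Suc s)"
    using conn unfolding induced_conn_columns
    by blast
  then have "c (Inr i, Suc s) = c (Inr i, s)"
    by (auto simp: star_columns_def mono_adj_def star_path_adj_def)
  ultimately show ?col
    by simp
next
  assume col: ?col
  let ?V = "star_columns m (Suc s) \<union> leaf_column m (Suc s)"
  have "(Inr i, Suc s) \<in> ?V" "(Inr i, s) \<in> ?V" "(Inl 0, s) \<in> ?V"
    using assms by (auto simp: star_columns_def leaf_column_def)
  moreover have "((Inr i, Suc s), (Inr i, s)) \<in> mono_adj c" "((Inr i, s), (Inl 0, s)) \<in> mono_adj c"
    using col by (auto simp: mono_adj_def star_path_adj_def)
  ultimately show ?conn
    by (blast intro: induced_conn_trans induced_conn_edge)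
qed

text \<open>The centre of column \<open>t\<close> merges exactly the leaves of its own colour in
  that column; any other connection between two leaves already existed before it was added. This is
  the recursion that \<open>linked\<close> solves.\<close>

lemma induced_conn_leaves_step:
  assumes "i < m" "j < m" "i \<noteq> j"
  shows "((Inr i, t), (Inr j, t)) \<in> induced_conn (mono_adj c) (star_columns m (Suc t)) \<longleftrightarrow>
    c (Inr i, t) = c (Inr j, t) \<and> (c (Inr i, t) = c (Inl 0, t) \<or>
    (\<exists>s. t = Suc s \<and> c (Inr i, s) = c (Inr i, t) \<and> c (Inr j, s) = c (Inr j, t) \<and>
      ((Inr i, s), (Inr j, s)) \<in> induced_conn (mono_adj c) (star_columns m t)))"
    (is "?conn \<longleftrightarrow> ?rhs")
proof -
  let ?W = "star_columns m t \<union> leaf_column m t"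
  define T where "T = insert (Inl 0, t) {u. \<exists>w\<in>?W. ((Inl 0, t), w) \<in> mono_adj c \<and>
    (u, w) \<in> induced_conn (mono_adj c) ?W}"
  have "(Inl 0, t) \<notin> ?W"
    by (auto simp: star_columns_def leaf_column_def)
  then have conn: "induced_conn (mono_adj c) (star_columns m (Suc t)) = induced_conn (mono_adj c) ?W \<union> T \<times> T"
    unfolding star_columns_Suc T_def by (intro induced_conn_insert sym_mono_adj)
  have T: "(Inr k, t) \<in> T \<longleftrightarrow> c (Inr k, t) = c (Inl 0, t)" if "k < m" for k
  proof
    assume "(Inr k, t) \<in> T"
    then obtain w where "((Inl 0, t), w) \<in> mono_adj c" "c (Inr k, t) = c w"
      by (auto simp: T_def dest: induced_conn_mono_adj_color)
    then show "c (Inr k, t) = c (Inl 0, t)"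
      by (simp add: mono_adj_def)
  next
    assume "c (Inr k, t) = c (Inl 0, t)"
    then have "((Inl 0, t), (Inr k, t)) \<in> mono_adj c"
      by (simp add: mono_adj_def star_path_adj_def)
    moreover have "(Inr k, t) \<in> ?W"
      using that by (auto simp: leaf_column_def)
    ultimately show "(Inr k, t) \<in> T"
      by (auto simp: T_def intro: induced_conn_refl)
  qed
  have "?conn \<Longrightarrow> c (Inr i, t) = c (Inr j, t)"
    by (rule induced_conn_mono_adj_color)
  moreover have "?conn \<longleftrightarrow> c (Inr i, t) = c (Inl 0, t) \<and> c (Inr j, t) = c (Inl 0, t) \<or>
     (\<exists>s. t = Suc s \<and> c (Inr i, s) = c (Inr i, t) \<and> c (Inr j, s) = c (Inr j, t) \<and>
      ((Inr i, s), (Inr j, s)) \<in> induced_conn (mono_adj c) (star_columns m t))"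
    unfolding conn using T assms induced_conn_leaf_column[OF assms] by auto
  ultimately show ?thesis by metis
qed

text \<open>The column \<open>s\<close> is the last one up to \<open>t\<close> whose centre has
  colour \<open>x\<close>; both leaf rows keep colour \<open>x\<close> from there to
  \<open>t\<close>. The connecting path runs back along one row, through that centre, and forward
  along the other.\<close>

definition linked :: "((nat + nat) \<times> nat \<Rightarrow> 'c) \<Rightarrow> nat \<Rightarrow> nat \<Rightarrow> 'c \<Rightarrow> nat \<Rightarrow> nat \<Rightarrow> bool" where
  "linked c i j x s t \<longleftrightarrow> s \<le> t \<and> c (Inl 0, s) = x \<and> (\<forall>r\<in>{s<..t}. c (Inl 0, r) \<noteq> x) \<and>
      (\<forall>r\<in>{s..t}. c (Inr i, r) = x \<and> c (Inr j, r) = x)"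

lemma linked_end: "linked c i j x s t \<Longrightarrow> c (Inr i, t) = x \<and> c (Inr j, t) = x"
  by (simp add: linked_def)

lemma linked_0: "linked c i j x s 0 \<longleftrightarrow> s = 0 \<and> c (Inl 0, 0) = x \<and> c (Inr i, 0) = x \<and> c (Inr j, 0) = x"
  by (auto simp: linked_def)

lemma linked_Suc:
  "linked c i j x s (Suc t) \<longleftrightarrow> c (Inr i, Suc t) = x \<and> c (Inr j, Suc t) = x \<and>
    (if c (Inl 0, Suc t) = x then s = Suc t else linked c i j x s t)"
proof (cases "s \<le> t")
  case True
  then have "{s..Suc t} = insert (Suc t) {s..t}" "{s<..Suc t} = insert (Suc t) {s<..t}"
    by auto
  then show ?thesis
    using True by (auto simp: linked_def)
next
  case False
  then show ?thesis
    by (auto simp: linked_def le_Suc_eq)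
qed

text \<open>By \<open>linked_Suc\<close> and \<open>induced_conn_leaves_step\<close>, both sides
  obey the same recursion in \<open>t\<close>: a centre of the right colour restarts the link, any
  other centre passes on the earlier one.\<close>

lemma induced_conn_leaves_iff:
  assumes "i < m" "j < m" "i \<noteq> j"
  shows "((Inr i, t), (Inr j, t)) \<in> induced_conn (mono_adj c) (star_columns m (Suc t)) \<longleftrightarrow>
    (\<exists>s. linked c i j (c (Inr i, t)) s t)"
proof (induction t)
  case 0
  then show ?case
    using induced_conn_leaves_step[OF assms, of 0 c] by (auto simp: linked_0)
next
  case (Suc t)
  define x where "x = c (Inr i, Suc t)"
  have "((Inr i, Suc t), (Inr j, Suc t)) \<in> induced_conn (mono_adj c) (star_columns m (Suc (Suc t))) \<longleftrightarrow>
    c (Inr j, Suc t) = x \<and> (c (Inl 0, Suc t) = x \<or>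
      c (Inr i, t) = x \<and> c (Inr j, t) = x \<and> (\<exists>s. linked c i j (c (Inr i, t)) s t))"
    unfolding induced_conn_leaves_step[OF assms] x_def using Suc.IH by auto
  also have "\<dots> \<longleftrightarrow> c (Inr j, Suc t) = x \<and> (c (Inl 0, Suc t) = x \<or> (\<exists>s. linked c i j x s t))"
    using linked_end[of c i j x _ t] by metis
  also have "\<dots> \<longleftrightarrow> (\<exists>s. linked c i j x s (Suc t))"
    by (auto simp: linked_Suc x_def)
  finally show ?case
    by (simp add: x_def)
qed

text \<open>A hole ending in column \<open>Suc t\<close> is a link up to column \<open>t\<close>
  that the next centre closes: the centres strictly between \<open>s\<close> and
  \<open>Suc t\<close> are those after \<open>s\<close> up to \<open>t\<close>.\<close>

lemma hole_pair_iff_linked: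
  assumes "s \<le> t" "c (Inl 0, t) \<noteq> c (Inl 0, Suc t)"
    and "c (Inr i, Suc t) = c (Inl 0, Suc t)" "c (Inr j, Suc t) = c (Inl 0, Suc t)"
  shows "hole c {i, j} s (Suc t) \<longleftrightarrow> linked c i j (c (Inl 0, Suc t)) s t"
proof -
  have "{s..Suc t} = insert (Suc t) {s..t}" "{s<..<Suc t} = {s<..t}"
    using assms(1) by auto
  then show ?thesis
    using assms by (auto simp: hole_def linked_def)
qed

text \<open>A connection present before the centre is added comes from a link up to the previous
  column. The assumption on the previous centre excludes a link starting there, whence the bound
  \<open>s < t - 1\<close>.\<close>

lemma induced_conn_leaf_column_hole:
  assumes "i < m" "j < m" "i \<noteq> j"
    and col: "c (Inr i, t) = c (Inl 0, t)" "c (Inr j, t) = c (Inl 0, t)"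
    and ctr: "\<And>s. t = Suc s \<Longrightarrow> c (Inl 0, s) \<noteq> c (Inl 0, t)"
  shows "((Inr i, t), (Inr j, t)) \<in> induced_conn (mono_adj c) (star_columns m t \<union> leaf_column m t) \<longleftrightarrow>
    (\<exists>s<t - 1. hole c {i, j} s t)"
proof (cases t)
  case 0
  then show ?thesis
    using induced_conn_leaf_column[OF assms(1-3), of t c] by simp
next
  case (Suc t')
  define y where "y = c (Inl 0, t)"
  have "((Inr i, t), (Inr j, t)) \<in> induced_conn (mono_adj c) (star_columns m t \<union> leaf_column m t) \<longleftrightarrow>
    c (Inr i, t') = y \<and> c (Inr j, t') = y \<and> (\<exists>s. linked c i j (c (Inr i, t')) s t')"
    unfolding induced_conn_leaf_column[OF assms(1-3)]
    using induced_conn_leaves_iff[OF assms(1-3), of t' c] Suc col by (auto simp: y_def)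
  also have "\<dots> \<longleftrightarrow> (\<exists>s. linked c i j y s t')"
    using linked_end[of c i j y _ t'] by metis
  also have "\<dots> \<longleftrightarrow> (\<exists>s<t'. hole c {i, j} s t)"
  proof -
    have "s < t'" if "linked c i j y s t'" for s
      using that ctr[OF Suc] by (auto simp: linked_def y_def order.order_iff_strict)
    moreover have "linked c i j y s t' \<longleftrightarrow> hole c {i, j} s t" if "s < t'" for s
      using hole_pair_iff_linked[of s t' c i j] that ctr[OF Suc] col Suc by (simp add: y_def)
    ultimately show ?thesis by blast
  qed
  finally show ?thesis
    using Suc by simp
qed

text \<open>Inclusion-exclusion is exact here: an equivalence relation on three points relates
  0, 1 or 3 pairs.\<close>

lemma card_image_subset_3:
  fixes f :: "nat \<Rightarrow> 'b"
  assumes "D \<subseteq> {..<3}"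
  shows "real (card (f ` D)) = (\<Sum>i<3. of_bool (i \<in> D))
    - of_bool (0 \<in> D \<and> 1 \<in> D \<and> f 0 = f 1) - of_bool (0 \<in> D \<and> 2 \<in> D \<and> f 0 = f 2)
    - of_bool (1 \<in> D \<and> 2 \<in> D \<and> f 1 = f 2)
    + of_bool (0 \<in> D \<and> 1 \<in> D \<and> 2 \<in> D \<and> f 0 = f 1 \<and> f 1 = f 2)"
proof -
  have "{..<3::nat} = {0, 1, 2}" by auto
  then have "D \<in> Pow {0, 1, 2}" using assms by simp
  then have "D = {} \<or> D = {0} \<or> D = {1} \<or> D = {2} \<or> D = {0,1} \<or> D = {0,2} \<or> D = {1,2} \<or> D = {0,1,2}"
    by (simp add: Pow_insert) blast
  then show ?thesis
    by (elim disjE) (auto simp: card_insert_if numeral_3_eq_3 lessThan_Suc)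
qed

section \<open>Holes ending in a given column\<close>

text \<open>The start of a hole is the last earlier column whose centre has the colour of the centre
  of column \<open>t\<close>, whichever leaves are considered.\<close>

lemma hole_unique:
  assumes "hole c S s t" "hole c S' s' t" "s < t" "s' < t"
  shows "s = s'"
proof (rule ccontr)
  assume "s \<noteq> s'"
  then consider "s < s'" | "s' < s" by linarith
  then show False
    by cases (use assms in \<open>auto simp: hole_def\<close>)
qed

text \<open>By \<open>hole_unique\<close> at most one summand is nonzero. The sum form lets
  linearity of expectation apply.\<close>

lemma of_bool_ex_hole:
  "of_bool (\<exists>s<t - 1. hole c S s t) = (\<Sum>s<t - 1. of_bool (hole c S s t) :: real)"
proof (cases "\<exists>s<t - 1. hole c S s t")
  case True
  then obtain s where s: "s < t - 1" "hole c S s t" by blast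
  have "(\<Sum>r<t - 1. of_bool (hole c S r t) :: real) = (\<Sum>r<t - 1. if r = s then 1 else 0)"
  proof (intro sum.cong refl)
    fix r assume "r \<in> {..<t - 1}"
    then have "r < t" "s < t"
      using s(1) by auto
    then show "(of_bool (hole c S r t) :: real) = (if r = s then 1 else 0)"
      using s(2) hole_unique[of c S r t S s] by (cases "r = s") (simp, metis of_bool_eq(1))
  qed
  then show ?thesis
    using s by auto
next
  case False
  then show ?thesis by simp
qed

text \<open>Two pair holes ending in the same column also start in the same column, so their leaf
  conditions combine. This matches transitivity of connectedness among three leaves.\<close>

lemma hole_triple_iff:
  "(\<exists>s<t - 1. hole c {0, 1} s t) \<and> (\<exists>s<t - 1. hole c {1, 2} s t) \<longleftrightarrow> (\<exists>s<t - 1. hole c {0, 1, 2} s t)"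
proof
  assume "(\<exists>s<t - 1. hole c {0, 1} s t) \<and> (\<exists>s<t - 1. hole c {1, 2} s t)"
  then obtain s s' where s: "s < t - 1" "hole c {0, 1} s t" "s' < t - 1" "hole c {1, 2} s' t"
    by blast
  then have "s' = s"
    using hole_unique[OF s(4,2)] by linarith
  then have "hole c {0, 1, 2} s t"
    using s by (simp add: hole_def)
  then show "\<exists>s<t - 1. hole c {0, 1, 2} s t"
    using s by blast
qed (auto simp: hole_def)

section \<open>The change in the number of blocks caused by one column\<close>

text \<open>The terms are four vertices, edges from the centre to its leaves, horizontal edges less
  unit squares, and holes. Horizontal leaf edges are written by colours because every
  \<open>hole\<close> involves centres. Column 0 has no horizontal edges, and there
  \<open>t - 1\<close> would be truncated to 0.\<close>

definition column_gain :: "((nat + nat) \<times> nat \<Rightarrow> 'c) \<Rightarrow> nat \<Rightarrow> real" where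
  "column_gain c t = 4 - (\<Sum>i<3. of_bool (hole c {i} t t))
    - (if t = 0 then 0 else of_bool (hole c {} (t - 1) t)
        + (\<Sum>i<3. of_bool (c (Inr i, t - 1) = c (Inr i, t)))
        - (\<Sum>i<3. of_bool (hole c {i} (t - 1) t)))
    + (\<Sum>s<t - 1. of_bool (hole c {0, 1} s t) + of_bool (hole c {0, 2} s t)
        + of_bool (hole c {1, 2} s t) - of_bool (hole c {0, 1, 2} s t))"

lemma component_count_leaf_column:
  "real (component_count (mono_adj c) (star_columns m t \<union> leaf_column m t))
    = real (component_count (mono_adj c) (star_columns m t)) + real m
      - (if t = 0 then 0 else \<Sum>i<m. of_bool (c (Inr i, t - 1) = c (Inr i, t)))"
proof -
  let ?L = "leaf_column m t" and ?V = "star_columns m t"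
  have inj: "inj (\<lambda>i. (Inr i, t) :: (nat + nat) \<times> nat)"
    by (auto simp: inj_def)
  have fin: "finite ?L"
    by (simp add: leaf_column_def)
  have "component_count (mono_adj c) (?V \<union> ?L) + card {l \<in> ?L. \<exists>w\<in>?V. (l, w) \<in> mono_adj c}
    = component_count (mono_adj c) ?V + card ?L"
    by (rule component_count_pendant[OF sym_mono_adj finite_star_columns fin])
      (simp add: leaf_column_pendant(1), metis leaf_column_pendant(2), metis leaf_column_pendant(3))
  moreover have "card ?L = m"
    unfolding leaf_column_def using inj by (simp add: card_image inj_on_subset)
  moreover have "real (card {l \<in> ?L. \<exists>w\<in>?V. (l, w) \<in> mono_adj c})
    = (if t = 0 then 0 else \<Sum>i<m. of_bool (c (Inr i, t - 1) = c (Inr i, t)))"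
  proof (cases t)
    case 0
    then show ?thesis by (simp add: star_columns_def)
  next
    case (Suc s)
    have "{l \<in> ?L. \<exists>w\<in>?V. (l, w) \<in> mono_adj c}
      = (\<lambda>i. (Inr i, t)) ` {i \<in> {..<m}. c (Inr i, s) = c (Inr i, t)}"
      unfolding Suc
      by (fastforce simp: star_columns_def leaf_column_def mono_adj_def star_path_adj_def)
    then have "card {l \<in> ?L. \<exists>w\<in>?V. (l, w) \<in> mono_adj c} = card {i \<in> {..<m}. c (Inr i, s) = c (Inr i, t)}"
      using inj by (simp add: card_image inj_on_subset)
    then show ?thesis
      using Suc by (simp add: Int_def of_bool_def sum.If_cases)
  qed
  ultimately show ?thesis by linarith
qed

text \<open>After the leaves, adding the centre removes as many blocks as there are distinct
  components among its neighbours of the same colour, and adds one. The count of these components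
  splits on whether the previous centre has the same colour.\<close>

lemma component_count_star_columns_Suc:
  "real (component_count (mono_adj c) (star_columns 3 (Suc t)))
    = real (component_count (mono_adj c) (star_columns 3 t)) + column_gain c t"
proof -
  let ?W = "star_columns 3 t \<union> leaf_column 3 t"
  let ?C = "\<lambda>w. induced_conn (mono_adj c) ?W `` {w}"
  let ?y = "c (Inl 0, t)"
  define N where "N = {w \<in> ?W. ((Inl 0, t), w) \<in> mono_adj c}"
  define D where "D = {i \<in> {..<3}. c (Inr i, t) = ?y}"
  define f where "f = (\<lambda>i::nat. ?C (Inr i, t))"
  have count: "component_count (mono_adj c) (star_columns 3 (Suc t)) + card (?C ` N)
    = component_count (mono_adj c) ?W + 1"
    unfolding star_columns_Suc N_def
  proof (rule component_count_insert[OF sym_mono_adj])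
    show "(Inl 0, t) \<notin> ?W" "finite ?W"
      by (auto simp: star_columns_def leaf_column_def)
  qed
  have C_eq: "?C u = ?C v \<longleftrightarrow> (u, v) \<in> induced_conn (mono_adj c) ?W" if "u \<in> ?W" "v \<in> ?W" for u v
    using eq_equiv_class_iff[OF equiv_induced_conn[OF sym_mono_adj] that] .
  have leaf_W: "(Inr i, t) \<in> ?W" if "i < 3" for i
    using that by (auto simp: leaf_column_def)
  have f_eq: "f i = f j \<longleftrightarrow> ((Inr i, t), (Inr j, t)) \<in> induced_conn (mono_adj c) ?W" if "i < 3" "j < 3" for i j
    unfolding f_def using C_eq leaf_W that by blast
  have h1: "hole c {i} t t \<longleftrightarrow> c (Inr i, t) = ?y" for i
    by (auto simp: hole_def)
  have D_iff: "i \<in> D \<longleftrightarrow> i < 3 \<and> c (Inr i, t) = ?y" for i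
    by (simp add: D_def)
  have sumD: "(\<Sum>i<3. of_bool (i \<in> D)) = (\<Sum>i<3. of_bool (hole c {i} t t) :: real)"
    by (intro sum.cong) (auto simp: D_iff h1)
  have "real (card (?C ` N)) = (\<Sum>i<3. of_bool (hole c {i} t t))
    + (if t = 0 then 0 else of_bool (hole c {} (t - 1) t) - (\<Sum>i<3. of_bool (hole c {i} (t - 1) t)))
    - (\<Sum>s<t - 1. of_bool (hole c {0, 1} s t) + of_bool (hole c {0, 2} s t)
        + of_bool (hole c {1, 2} s t) - of_bool (hole c {0, 1, 2} s t))"
  proof (cases "\<exists>s. t = Suc s \<and> c (Inl 0, s) = ?y")
    case True
    then obtain s where s: "t = Suc s" "c (Inl 0, s) = ?y" by blast
    \<comment> \<open>These leaves share the colour of the new centre but not that of their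
      predecessor, so they are still isolated. The remaining leaves of \<open>D\<close> lie in the
      component of the previous centre.\<close>
    define D' where "D' = {i \<in> D. c (Inr i, s) \<noteq> ?y}"
    \<comment> \<open>The centre of column \<open>t - 1\<close> would lie strictly inside such a
      hole while having the forbidden colour.\<close>
    have no: "\<not> hole c S r t" if "r < t - 1" for S r
      using that s by (auto simp: hole_def)
    have sW: "(Inl 0, s) \<in> ?W"
      using s by (auto simp: star_columns_def)
    have N: "N = insert (Inl 0, s) ((\<lambda>i. (Inr i, t)) ` D)"
      using s by (auto simp: N_def D_def star_columns_def leaf_column_def mono_adj_def star_path_adj_def)
    have fs: "f i = ?C (Inl 0, s) \<longleftrightarrow> i \<notin> D'" if "i \<in> D" for i
      using that C_eq[OF leaf_W sW, of i] induced_conn_leaf_centre[of i 3 s c] s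
      by (auto simp: f_def D'_def D_iff)
    have "?C ` N = insert (?C (Inl 0, s)) (f ` D)"
      by (simp add: N f_def image_image)
    also have "\<dots> = insert (?C (Inl 0, s)) (f ` D')"
      using fs by (auto simp: D'_def)
    finally have "?C ` N = insert (?C (Inl 0, s)) (f ` D')" .
    moreover have "?C (Inl 0, s) \<notin> f ` D'"
      using fs by (force simp: D'_def)
    moreover have "inj_on f D'"
    proof (rule inj_onI, rule ccontr)
      fix i j assume ij: "i \<in> D'" "j \<in> D'" "f i = f j" "i \<noteq> j"
      then have "i < 3" "j < 3"
        by (auto simp: D'_def D_iff)
      then show False
        using f_eq[of i j] induced_conn_leaf_column[of i 3 j t c] ij s by (auto simp: D'_def D_iff)
    qed
    moreover have "finite D'"
      by (simp add: D'_def D_def)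
    ultimately have card: "card (?C ` N) = 1 + card D'"
      by (simp add: card_image)
    have "real (card D') = (\<Sum>i<3. of_bool (i \<in> D'))"
    proof -
      have "D' = {i \<in> {..<3}. i \<in> D'}"
        by (auto simp: D'_def D_def)
      then show ?thesis
        by (simp add: of_bool_def sum.If_cases Int_def)
    qed
    \<comment> \<open>A leaf of \<open>D\<close> outside \<open>D'\<close> is one that completes a
      monochromatic unit square with both centres.\<close>
    also have "\<dots> = (\<Sum>i<3. of_bool (hole c {i} t t) - of_bool (hole c {i} s t))"
    proof (intro sum.cong refl)
      fix i :: nat assume "i \<in> {..<3}"
      moreover have "{s..t} = {s, t}" "{s<..<t} = {}"
        using s by auto
      ultimately show "of_bool (i \<in> D') = (of_bool (hole c {i} t t) - of_bool (hole c {i} s t) :: real)"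
        using s(2) by (auto simp: D'_def D_iff hole_def)
    qed
    finally have "real (card D') = (\<Sum>i<3. of_bool (hole c {i} t t) - of_bool (hole c {i} s t))" .
    moreover have "hole c {} s t"
      using s by (auto simp: hole_def)
    ultimately show ?thesis
      using card s(1) no by (simp add: sum_subtractf)
  next
    case False
    have N: "N = (\<lambda>i. (Inr i, t)) ` D"
      using False by (auto simp: N_def D_def star_columns_def leaf_column_def mono_adj_def star_path_adj_def)
    \<comment> \<open>The previous centre, if any, has another colour, so connected leaves of
      \<open>D\<close> form a pair hole. Conversely, a hole forces its leaves to have the colour of
      the final centre and hence to lie in \<open>D\<close>.\<close>
    have pair: "i \<in> D \<and> j \<in> D \<and> f i = f j \<longleftrightarrow> (\<exists>s<t - 1. hole c {i, j} s t)" if "i < 3" "j < 3" "i \<noteq> j" for i j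
    proof (cases "i \<in> D \<and> j \<in> D")
      case True
      then show ?thesis
        using f_eq[of i j] induced_conn_leaf_column_hole[of i 3 j c t] that False by (auto simp: D_iff)
    next
      case ij: False
      then show ?thesis
        using that by (auto simp: D_iff hole_def)
    qed
    have triple: "0 \<in> D \<and> 1 \<in> D \<and> 2 \<in> D \<and> f 0 = f 1 \<and> f 1 = f 2 \<longleftrightarrow> (\<exists>s<t - 1. hole c {0, 1, 2} s t)"
      unfolding hole_triple_iff[symmetric] using pair[of 0 1] pair[of 1 2] by auto
    have "card (?C ` N) = card (f ` D)"
      by (simp add: N f_def image_image)
    moreover have "real (card (f ` D)) = (\<Sum>i<3. of_bool (hole c {i} t t))
      - of_bool (\<exists>s<t - 1. hole c {0, 1} s t) - of_bool (\<exists>s<t - 1. hole c {0, 2} s t)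
      - of_bool (\<exists>s<t - 1. hole c {1, 2} s t) + of_bool (\<exists>s<t - 1. hole c {0, 1, 2} s t)"
    proof -
      have D: "D \<subseteq> {..<3}"
        by (auto simp: D_def)
      have e: "0 \<in> D \<and> 1 \<in> D \<and> f 0 = f 1 \<longleftrightarrow> (\<exists>s<t - 1. hole c {0, 1} s t)"
        "0 \<in> D \<and> 2 \<in> D \<and> f 0 = f 2 \<longleftrightarrow> (\<exists>s<t - 1. hole c {0, 2} s t)"
        "1 \<in> D \<and> 2 \<in> D \<and> f 1 = f 2 \<longleftrightarrow> (\<exists>s<t - 1. hole c {1, 2} s t)"
        by (rule pair; simp)+
      show ?thesis
        using card_image_subset_3[OF D, of f] unfolding e triple sumD .
    qed
    \<comment> \<open>The horizontal centre edge and the unit squares all require the two centres to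
      agree, so their terms vanish in this case.\<close>
    moreover have "t \<noteq> 0 \<Longrightarrow> \<not> hole c S (t - 1) t" for S
      using False by (cases t) (auto simp: hole_def)
    then have "(if t = 0 then 0 else of_bool (hole c {} (t - 1) t)
      - (\<Sum>i<3. of_bool (hole c {i} (t - 1) t))) = (0 :: real)"
      by simp
    ultimately show ?thesis
      unfolding of_bool_ex_hole sum.distrib sum_subtractf by linarith
  qed
  moreover have "real (component_count (mono_adj c) (star_columns 3 (Suc t))) + real (card (?C ` N))
    = real (component_count (mono_adj c) ?W) + 1"
    using count by linarith
  ultimately show ?thesis
    unfolding column_gain_def component_count_leaf_column[of c 3 t]
    by (cases "t = 0") (simp_all only: if_True if_False, simp_all)
qed

lemma component_count_star_columns:
  "real (component_count (mono_adj c) (star_columns 3 n)) = (\<Sum>t<n. column_gain c t)"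
proof (induction n)
  case 0
  then show ?case by (simp add: component_count_def star_columns_def quotient_def)
next
  case (Suc n)
  then show ?case by (simp add: component_count_star_columns_Suc)
qed

section \<open>Expectations\<close>

lemma edges_path_graph_iff:
  "s < n \<Longrightarrow> t < n \<Longrightarrow> {s, t} \<in> edges (path_graph n) \<longleftrightarrow> t = Suc s \<or> s = Suc t"
  by (auto simp: path_graph_def doubleton_eq_iff)

lemma edges_star_iff:
  assumes "p \<in> Inl ` {..<1} \<union> Inr ` {..<m}" "q \<in> Inl ` {..<1} \<union> Inr ` {..<m}"
  shows "{p, q} \<in> edges (complete_bipartite 1 m) \<longleftrightarrow>
    p = Inl 0 \<and> (\<exists>i. q = Inr i) \<or> q = Inl 0 \<and> (\<exists>i. p = Inr i)"
  using assms by (auto simp: complete_bipartite_def doubleton_eq_iff)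

lemma edges_cartesian_product_iff:
  assumes "p \<in> vertices G" "q \<in> vertices G" "s \<in> vertices H" "t \<in> vertices H"
  shows "{(p, s), (q, t)} \<in> edges (cartesian_product G H) \<longleftrightarrow>
    p = q \<and> {s, t} \<in> edges H \<or> s = t \<and> {p, q} \<in> edges G" (is "?L \<longleftrightarrow> ?R")
proof
  assume ?L
  then show ?R
    by (auto simp: cartesian_product_def doubleton_eq_iff insert_commute)
next
  assume ?R
  then show ?L
    using assms unfolding cartesian_product_def by auto
qed

lemma edges_star_path:
  assumes "u \<in> star_columns m n" "v \<in> star_columns m n"
  shows "{u, v} \<in> edges (cartesian_product (complete_bipartite 1 m) (path_graph n)) \<longleftrightarrow> (u, v) \<in> star_path_adj"
proof -
  obtain p s q t where uv: "u = (p, s)" "v = (q, t)"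
    by (metis surj_pair)
  have mem: "p \<in> Inl ` {..<1} \<union> Inr ` {..<m}" "q \<in> Inl ` {..<1} \<union> Inr ` {..<m}" "s < n" "t < n"
    using assms by (auto simp: uv star_columns_def)
  have "{u, v} \<in> edges (cartesian_product (complete_bipartite 1 m) (path_graph n)) \<longleftrightarrow>
    p = q \<and> {s, t} \<in> edges (path_graph n) \<or> s = t \<and> {p, q} \<in> edges (complete_bipartite 1 m)"
    unfolding uv by (rule edges_cartesian_product_iff)
      (use mem in \<open>simp_all add: complete_bipartite_def path_graph_def\<close>)
  also have "\<dots> \<longleftrightarrow> (u, v) \<in> star_path_adj"
    unfolding edges_path_graph_iff[OF mem(3,4)] edges_star_iff[OF mem(1,2)]
    by (auto simp: uv star_path_adj_def)
  finally show ?thesis .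
qed

text \<open>Edges of the product have both ends in its vertex set, so \<open>mono_adj c\<close>
  restricted to \<open>star_columns m n\<close> is the adjacency of the monochromatic subgraph and
  both notions of component coincide.\<close>

lemma card_blocks_star_path:
  "card (blocks (cartesian_product (complete_bipartite 1 m) (path_graph n)) c)
    = component_count (mono_adj c) (star_columns m n)"
proof -
  define G where "G = cartesian_product (complete_bipartite 1 m) (path_graph n)"
  let ?V = "star_columns m n"
  have V: "vertices G = ?V"
    by (simp add: G_def cartesian_product_def complete_bipartite_def path_graph_def star_columns_def)
  have sub: "u \<in> ?V \<and> v \<in> ?V" if "{u, v} \<in> edges G" for u v
    using that unfolding V[symmetric] by (auto simp: G_def cartesian_product_def doubleton_eq_iff)
  have mono: "{x, y} \<in> edges (monochromatic_subgraph G c) \<longleftrightarrow> {x, y} \<in> edges G \<and> c x = c y" for x y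
  proof -
    have "(\<forall>u\<in>{x, y}. \<forall>v\<in>{x, y}. c u = c v) \<longleftrightarrow> c x = c y"
      by (metis insertCI insertE singletonD)
    then show ?thesis
      unfolding monochromatic_subgraph_def ugraph.select_convs mem_Collect_eq by blast
  qed
  have "{(x, y). {x, y} \<in> edges (monochromatic_subgraph G c)} = mono_adj c \<inter> ?V \<times> ?V"
  proof (intro equalityI subrelI)
    fix x y assume "(x, y) \<in> {(x, y). {x, y} \<in> edges (monochromatic_subgraph G c)}"
    then have xy: "{x, y} \<in> edges G" "c x = c y"
      by (simp_all add: mono)
    then show "(x, y) \<in> mono_adj c \<inter> ?V \<times> ?V"
      using sub[OF xy(1)] edges_star_path[of x m n y, folded G_def] by (simp add: mono_adj_def)
  next
    fix x y assume "(x, y) \<in> mono_adj c \<inter> ?V \<times> ?V"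
    then show "(x, y) \<in> {(x, y). {x, y} \<in> edges (monochromatic_subgraph G c)}"
      using edges_star_path[of x m n y, folded G_def] by (simp add: mono_adj_def mono)
  qed
  then show ?thesis
    unfolding G_def[symmetric]
    by (simp add: blocks_def components_def connected_rel_def component_count_def induced_conn_def
        monochromatic_subgraph_def V)
qed

section \<open>Probabilities of colour patterns\<close>

text \<open>With two colours, differing from \<open>x\<close> fixes the colour, so each choice of
  \<open>x\<close> prescribes every vertex of \<open>A \<union> B\<close>. The factor 2 counts the
  choices of \<open>x\<close>, which are disjoint events because \<open>A\<close> is
  nonempty.\<close>

lemma prob_color_pattern:
  assumes "finite V" "A \<union> B \<subseteq> V" "A \<inter> B = {}" "A \<noteq> {}"
  shows "measure_pmf.prob (Pi_pmf V d (\<lambda>_. pmf_of_set {..<2::nat}))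
      {c. \<exists>x. (\<forall>v\<in>A. c v = x) \<and> (\<forall>v\<in>B. c v \<noteq> x)} = 2 * (1 / 2) ^ card (A \<union> B)"
proof -
  let ?M = "Pi_pmf V d (\<lambda>_. pmf_of_set {..<2::nat})"
  \<comment> \<open>Writing the event as a product set makes its probability a product over the
    vertices.\<close>
  define F where "F x = Pi V (\<lambda>v. if v \<in> A then {x} else if v \<in> B then - {x} else UNIV)" for x :: nat
  have F: "F x = {c. (\<forall>v\<in>A. c v = x) \<and> (\<forall>v\<in>B. c v \<noteq> x)}" for x
  proof -
    have "c v \<in> (if v \<in> A then {x} else if v \<in> B then - {x} else UNIV) \<longleftrightarrow>
      (v \<in> A \<longrightarrow> c v = x) \<and> (v \<in> B \<longrightarrow> c v \<noteq> x)" for c v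
      using assms(3) by auto
    then have "F x = {c. \<forall>v\<in>V. (v \<in> A \<longrightarrow> c v = x) \<and> (v \<in> B \<longrightarrow> c v \<noteq> x)}"
      unfolding F_def Pi_def by auto
    then show ?thesis
      using assms(2) by blast
  qed
  have prob_F: "measure_pmf.prob ?M (F x) = (1 / 2) ^ card (A \<union> B)" if "x < 2" for x
  proof -
    have x: "{..<2} \<inter> {x} = {x}" "{..<2} \<inter> - {x} = {1 - x}"
      using less_2_cases[OF that] by auto
    have ne: "{..<2::nat} \<noteq> {}"
      using that by blast
    have "measure_pmf.prob ?M (F x) = (\<Prod>v\<in>V. if v \<in> A \<union> B then 1 / 2 else 1)"
      unfolding F_def measure_Pi_pmf_Pi[OF assms(1)]
      by (intro prod.cong) (auto simp: measure_pmf_of_set x ne)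
    also have "\<dots> = (1 / 2) ^ card (A \<union> B)"
    proof -
      have "V \<inter> {v. v \<in> A \<union> B} = A \<union> B"
        using assms(2) by auto
      then show ?thesis
        using assms(1) by (simp add: prod.If_cases del: Un_iff)
    qed
    finally show ?thesis .
  qed
  obtain a where a: "a \<in> A" "a \<in> V" using assms by auto
  have ca: "c a = 0 \<or> c a = 1" if "c \<in> set_pmf ?M" for c
  proof -
    have "c a < 2"
      using that a assms(1) by (auto simp: set_Pi_pmf PiE_dflt_def lessThan_empty_iff)
    then show ?thesis by auto
  qed
  \<comment> \<open>Colours are arbitrary natural numbers here; only on the support must
    \<open>x\<close> be 0 or 1, as the colour of \<open>a\<close> shows.\<close>
  have "{c. \<exists>x. (\<forall>v\<in>A. c v = x) \<and> (\<forall>v\<in>B. c v \<noteq> x)} \<inter> set_pmf ?M = (F 0 \<union> F 1) \<inter> set_pmf ?M"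
  proof (intro equalityI subsetI)
    fix c assume "c \<in> {c. \<exists>x. (\<forall>v\<in>A. c v = x) \<and> (\<forall>v\<in>B. c v \<noteq> x)} \<inter> set_pmf ?M"
    then obtain x where x: "c \<in> F x" "c \<in> set_pmf ?M"
      by (auto simp only: F)
    then have "x = 0 \<or> x = 1"
      using a(1) ca[of c] by (auto simp: F)
    then show "c \<in> (F 0 \<union> F 1) \<inter> set_pmf ?M"
      using x by auto
  qed (auto simp only: F)
  from arg_cong[OF this, of "measure_pmf.prob ?M"] have "measure_pmf.prob ?M {c. \<exists>x. (\<forall>v\<in>A. c v = x) \<and> (\<forall>v\<in>B. c v \<noteq> x)}
    = measure_pmf.prob ?M (F 0 \<union> F 1)"
    by (simp only: measure_Int_set_pmf)
  also have "\<dots> = measure_pmf.prob ?M (F 0) + measure_pmf.prob ?M (F 1)"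
    using a by (intro measure_pmf.finite_measure_Union) (auto simp: F)
  finally show ?thesis
    by (simp add: prob_F)
qed

definition star_coloring :: "nat \<Rightarrow> nat \<Rightarrow> ((nat + nat) \<times> nat \<Rightarrow> nat) pmf" where
  "star_coloring m n = Pi_pmf (star_columns m n) undefined (\<lambda>_. pmf_of_set {..<2})"

text \<open>The support is finite, so linearity of expectation applies to every real function of the
  colouring.\<close>

lemma integrable_star_coloring:
  fixes f :: "_ \<Rightarrow> real"
  shows "integrable (star_coloring m n) f"
proof (rule integrable_measure_pmf_finite)
  have "finite (PiE_dflt (star_columns m n) undefined (set_pmf \<circ> (\<lambda>_. pmf_of_set {..<2::nat})))"
    by (intro finite_PiE_dflt) (auto simp: star_columns_def lessThan_empty_iff)
  then show "finite (set_pmf (star_coloring m n))"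
    unfolding star_coloring_def by (subst set_Pi_pmf) (auto simp: star_columns_def)
qed

lemma expectation_of_bool:
  "measure_pmf.expectation M (\<lambda>c. of_bool (P c) :: real) = measure_pmf.prob M {c. P c}"
proof -
  have "(\<lambda>c. of_bool (P c)) = (indicator {c. P c} :: _ \<Rightarrow> real)"
    by (auto simp: indicator_def)
  then show ?thesis by simp
qed

text \<open>A hole prescribes, up to the choice of its colour, all centres and all leaves of
  \<open>S\<close> in the \<open>t - s + 1\<close> columns from \<open>s\<close> to
  \<open>t\<close>. The degenerate holes for edges and unit squares are included.\<close>

lemma expectation_hole:
  assumes "s \<le> t" "t < n" "S \<subseteq> {..<m}"
  shows "measure_pmf.expectation (star_coloring m n) (\<lambda>c. of_bool (hole c S s t) :: real)
    = 2 * (1 / 2) ^ ((1 + card S) * (t - s + 1))"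
proof -
  let ?A = "{(Inl 0, s), (Inl 0, t)} \<union> Inr ` S \<times> {s..t} :: ((nat + nat) \<times> nat) set"
  let ?B = "{Inl 0} \<times> {s<..<t} :: ((nat + nat) \<times> nat) set"
  have "{c :: _ \<Rightarrow> nat. hole c S s t} = {c. \<exists>x. (\<forall>v\<in>?A. c v = x) \<and> (\<forall>v\<in>?B. c v \<noteq> x)}"
    by (auto simp: hole_def)
  moreover have "?A \<union> ?B = insert (Inl 0) (Inr ` S) \<times> {s..t}"
    using assms(1) by (auto simp: order.order_iff_strict)
  moreover have "card (insert (Inl 0) (Inr ` S) \<times> {s..t} :: ((nat + nat) \<times> nat) set) = (1 + card S) * (t - s + 1)"
  proof -
    have "finite S" using assms(3) finite_subset by blast
    moreover have "inj_on Inr S" by simp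
    ultimately have "card (insert (Inl 0) (Inr ` S) :: (nat + nat) set) = 1 + card S"
      by (subst card_insert_disjoint) (auto simp: card_image)
    then show ?thesis
      using assms(1) by (simp add: card_cartesian_product Suc_diff_le)
  qed
  moreover have "measure_pmf.prob (star_coloring m n) {c. \<exists>x. (\<forall>v\<in>?A. c v = x) \<and> (\<forall>v\<in>?B. c v \<noteq> x)}
    = 2 * (1 / 2) ^ card (?A \<union> ?B)"
    unfolding star_coloring_def
    by (rule prob_color_pattern) (use assms in \<open>auto simp: star_columns_def\<close>)
  ultimately show ?thesis
    by (simp only: expectation_of_bool)
qed

lemma expectation_leaf_edge:
  assumes "Suc t < n" "i < m"
  shows "measure_pmf.expectation (star_coloring m n) (\<lambda>c. of_bool (c (Inr i, t) = c (Inr i, Suc t)) :: real) = 1 / 2"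
proof -
  let ?A = "{(Inr i, t), (Inr i, Suc t)} :: ((nat + nat) \<times> nat) set"
  have "{c :: _ \<Rightarrow> nat. c (Inr i, t) = c (Inr i, Suc t)} = {c. \<exists>x. (\<forall>v\<in>?A. c v = x) \<and> (\<forall>v\<in>{}. c v \<noteq> x)}"
    by auto
  moreover have "measure_pmf.prob (star_coloring m n) {c. \<exists>x. (\<forall>v\<in>?A. c v = x) \<and> (\<forall>v\<in>{}. c v \<noteq> x)}
    = 2 * (1 / 2) ^ card (?A \<union> {})"
    unfolding star_coloring_def
    by (rule prob_color_pattern) (use assms in \<open>auto simp: star_columns_def\<close>)
  ultimately show ?thesis
    by (simp only: expectation_of_bool) (simp add: power2_eq_square)
qed

section \<open>Summing the expected gains\<close>

text \<open>For \<open>t = k + 1\<close>, the exponent is the number of columns from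
  \<open>s\<close> to \<open>t\<close>; it runs from 3 to \<open>k + 2\<close>, since a proper hole
  spans at least three columns.\<close>

lemma sum_geometric_shifted:
  fixes a :: real
  assumes "a \<noteq> 1"
  shows "(\<Sum>s<k. a ^ (k + 2 - s)) = a ^ 3 * (1 - a ^ k) / (1 - a)"
proof -
  have "(\<Sum>s<k. a ^ (k + 2 - s)) = (\<Sum>j<k. a ^ (j + 3))"
    by (rule sum.reindex_bij_witness[where i = "\<lambda>j. k - Suc j" and j = "\<lambda>s. k - Suc s"])
      (auto simp: numeral_eq_Suc Suc_diff_Suc Suc_diff_le)
  also have "\<dots> = a ^ 3 * (\<Sum>j<k. a ^ j)"
    by (simp add: power_add sum_distrib_right mult.commute[of "a ^ 3"])
  also have "\<dots> = a ^ 3 * (1 - a ^ k) / (1 - a)"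
    using assms by (simp add: sum_gp_strict)
  finally show ?thesis .
qed

lemma expectation_column_gain:
  assumes "t < n"
  shows "measure_pmf.expectation (star_coloring 3 n) (\<lambda>c. column_gain c t)
    = (if t = 0 then 5 / 2 else 7 / 8 + 3 / 224 * (1 - (1 / 8) ^ (t - 1)) - 1 / 1920 * (1 - (1 / 16) ^ (t - 1)))"
proof (cases t)
  case 0
  show ?thesis
    using assms unfolding column_gain_def 0
    by (simp add: integrable_star_coloring expectation_hole del: sum_of_bool_eq)
next
  case (Suc k)
  let ?E = "\<lambda>f :: _ \<Rightarrow> real. measure_pmf.expectation (star_coloring 3 n) f"
  have "?E (\<lambda>c. column_gain c t) = 4 - (\<Sum>i<3. ?E (\<lambda>c. of_bool (hole c {i} t t)))
    - (?E (\<lambda>c. of_bool (hole c {} k t)) + (\<Sum>i<3. ?E (\<lambda>c. of_bool (c (Inr i, k) = c (Inr i, Suc k))))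
        - (\<Sum>i<3. ?E (\<lambda>c. of_bool (hole c {i} k t))))
    + (\<Sum>s<k. ?E (\<lambda>c. of_bool (hole c {0, 1} s t)) + ?E (\<lambda>c. of_bool (hole c {0, 2} s t))
        + ?E (\<lambda>c. of_bool (hole c {1, 2} s t)) - ?E (\<lambda>c. of_bool (hole c {0, 1, 2} s t)))"
    unfolding column_gain_def Suc by (simp add: integrable_star_coloring del: sum_of_bool_eq)
  \<comment> \<open>Each edge is monochromatic with probability 1/2 and each unit square with
    probability 2/16. Three pair holes of weight \<open>2 * (1 / 8) ^ p\<close> give the factor 6,
    the triple hole gives \<open>2 * (1 / 16) ^ p\<close>.\<close>
  also have "\<dots> = 4 - (\<Sum>i<3::nat. 1 / 2) - (1 / 2 + (\<Sum>i<3::nat. 1 / 2) - (\<Sum>i<3::nat. 1 / 8))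
    + (\<Sum>s<k. 6 * (1 / 8) ^ (k + 2 - s) - 2 * (1 / 16) ^ (k + 2 - s))"
  proof -
    have pair: "?E (\<lambda>c. of_bool (hole c {i, j} s t)) = 2 * (1 / 8) ^ (k + 2 - s)"
      if "i < 3" "j < 3" "i \<noteq> j" "s < k" for i j s
    proof -
      have "t - s + 1 = k + 2 - s" "card {i, j} = 2"
        using that Suc by auto
      moreover have "?E (\<lambda>c. of_bool (hole c {i, j} s t)) = 2 * (1 / 2) ^ ((1 + card {i, j}) * (t - s + 1))"
        by (rule expectation_hole) (use that Suc assms in auto)
      moreover have "(1 / 2 :: real) ^ ((1 + 2) * p) = (1 / 8) ^ p" for p
        unfolding power_mult by (simp add: power_divide)
      ultimately show ?thesis by (simp only:)
    qed
    have triple: "?E (\<lambda>c. of_bool (hole c {0, 1, 2} s t)) = 2 * (1 / 16) ^ (k + 2 - s)"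
      if "s < k" for s
    proof -
      have "t - s + 1 = k + 2 - s" "card {0::nat, 1, 2} = 3"
        using that Suc by auto
      moreover have "?E (\<lambda>c. of_bool (hole c {0, 1, 2} s t)) = 2 * (1 / 2) ^ ((1 + card {0::nat, 1, 2}) * (t - s + 1))"
        by (rule expectation_hole) (use that Suc assms in auto)
      moreover have "(1 / 2 :: real) ^ ((1 + 3) * p) = (1 / 16) ^ p" for p
        unfolding power_mult by (simp add: power_divide)
      ultimately show ?thesis by (simp only:)
    qed
    have "?E (\<lambda>c. of_bool (hole c {i} t t)) = 1 / 2" "?E (\<lambda>c. of_bool (hole c {i} k t)) = 1 / 8"
      "?E (\<lambda>c. of_bool (c (Inr i, k) = c (Inr i, Suc k))) = 1 / 2" if "i < 3" for i
      using that assms Suc expectation_leaf_edge[of k n i 3]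
      by (simp_all add: expectation_hole power_divide)
    then have "(\<Sum>i<3. ?E (\<lambda>c. of_bool (hole c {i} t t))) = (\<Sum>i<3::nat. 1 / 2)"
      "(\<Sum>i<3. ?E (\<lambda>c. of_bool (hole c {i} k t))) = (\<Sum>i<3::nat. 1 / 8)"
      "(\<Sum>i<3. ?E (\<lambda>c. of_bool (c (Inr i, k) = c (Inr i, Suc k)))) = (\<Sum>i<3::nat. 1 / 2)"
      by (intro sum.cong refl; simp only: lessThan_iff)+
    moreover have "?E (\<lambda>c. of_bool (hole c {} k t)) = 1 / 2"
      using assms Suc by (simp add: expectation_hole power_divide)
    moreover have "(\<Sum>s<k. ?E (\<lambda>c. of_bool (hole c {0, 1} s t)) + ?E (\<lambda>c. of_bool (hole c {0, 2} s t))
        + ?E (\<lambda>c. of_bool (hole c {1, 2} s t)) - ?E (\<lambda>c. of_bool (hole c {0, 1, 2} s t)))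
      = (\<Sum>s<k. 6 * (1 / 8) ^ (k + 2 - s) - 2 * (1 / 16) ^ (k + 2 - s))"
    proof (intro sum.cong refl)
      fix s assume "s \<in> {..<k}"
      then show "?E (\<lambda>c. of_bool (hole c {0, 1} s t)) + ?E (\<lambda>c. of_bool (hole c {0, 2} s t))
        + ?E (\<lambda>c. of_bool (hole c {1, 2} s t)) - ?E (\<lambda>c. of_bool (hole c {0, 1, 2} s t))
        = 6 * (1 / 8) ^ (k + 2 - s) - 2 * (1 / 16) ^ (k + 2 - s)"
        using pair[of 0 1 s] pair[of 0 2 s] pair[of 1 2 s] triple[of s] by simp
    qed
    ultimately show ?thesis
      by (simp only:)
  qed
  also have "\<dots> = 7 / 8 + 6 * (\<Sum>s<k. (1 / 8) ^ (k + 2 - s)) - 2 * (\<Sum>s<k. (1 / 16) ^ (k + 2 - s))"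
    by (simp add: sum_subtractf sum_distrib_left)
  also have "\<dots> = 7 / 8 + 3 / 224 * (1 - (1 / 8) ^ k) - 1 / 1920 * (1 - (1 / 16) ^ k)"
  proof -
    have ne: "(1 / 8 :: real) \<noteq> 1" "(1 / 16 :: real) \<noteq> 1"
      by simp_all
    \<comment> \<open>The constants are 6/512 divided by 7/8 and 2/4096 divided by 15/16.\<close>
    have eq: "7 / 8 + 6 * ((1 / 8) ^ 3 * (1 - a) / (1 - 1 / 8)) - 2 * ((1 / 16) ^ 3 * (1 - b) / (1 - 1 / 16))
      = 7 / 8 + 3 / 224 * (1 - a) - 1 / 1920 * (1 - b)" for a b :: real
      by (simp add: power3_eq_cube field_simps)
    show ?thesis
      unfolding sum_geometric_shifted[OF ne(1)] sum_geometric_shifted[OF ne(2)] by (rule eq)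
  qed
  finally show ?thesis
    using Suc by simp
qed

text \<open>The slope is 7/8 + 3/224 - 1/1920. The coefficients 6/49 and -2/225 come from summing
  the powers of 1/8 and 1/16 once more, and the first column fixes the constant.\<close>

lemma sum_column_expectations:
  "(\<Sum>t<Suc k. if t = 0 then 5 / 2
      else 7 / 8 + 3 / 224 * (1 - (1 / 8) ^ (t - 1)) - 1 / 1920 * (1 - (1 / 16) ^ (t - 1)) :: real)
    = 2254219 / 1411200 + 6 / 49 * (1 / 8) ^ Suc k - 2 / 225 * (1 / 16) ^ Suc k + 11933 / 13440 * real (Suc k)"
proof (induction k)
  case 0
  then show ?case by simp
next
  case (Suc k)
  have pow: "(1 / 8 :: real) ^ Suc k = (1 / 8) ^ k / 8" "(1 / 8 :: real) ^ Suc (Suc k) = (1 / 8) ^ k / 64"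
    "(1 / 16 :: real) ^ Suc k = (1 / 16) ^ k / 16" "(1 / 16 :: real) ^ Suc (Suc k) = (1 / 16) ^ k / 256"
    by simp_all
  \<comment> \<open>With \<open>a\<close>, \<open>b\<close> and \<open>x\<close> for
    \<open>(1 / 8) ^ k\<close>, \<open>(1 / 16) ^ k\<close> and \<open>real k\<close>, the induction
    step is an identity linear in three unknowns.\<close>
  have step: "2254219 / 1411200 + 6 / 49 * (a / 8) - 2 / 225 * (b / 16) + 11933 / 13440 * (1 + x)
      + (7 / 8 + 3 / 224 * (1 - a) - 1 / 1920 * (1 - b))
    = 2254219 / 1411200 + 6 / 49 * (a / 64) - 2 / 225 * (b / 256) + 11933 / 13440 * (1 + (1 + x))" for a b x :: real
    by (simp add: field_simps)
  show ?case
    unfolding sum.lessThan_Suc[of _ "Suc k"] Suc.IH pow of_nat_Suc diff_Suc_1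
    by (simp only: nat.distinct if_False) (rule step)
qed

theorem corollary7p2:
  fixes n :: nat
  assumes "n \<ge> 1"
  shows "measure_pmf.expectation (block_count 2 (cartesian_product (complete_bipartite 1 3) (path_graph n))) real
    = 2254219 / 1411200 + 6 / 49 * 2 powi (- 3 * int n) - 2 / 225 * 2 powi (- 4 * int n)
      + 11933 / 13440 * real n"
proof -
  let ?G = "cartesian_product (complete_bipartite 1 3) (path_graph n)"
  have "random_coloring 2 ?G = star_coloring 3 n"
    by (simp add: random_coloring_def star_coloring_def star_columns_def
        cartesian_product_def complete_bipartite_def path_graph_def)
  then have "measure_pmf.expectation (block_count 2 ?G) real
    = measure_pmf.expectation (star_coloring 3 n) (\<lambda>c. \<Sum>t<n. column_gain c t)"
    by (simp only: block_count_def integral_map_pmf card_blocks_star_path component_count_star_columns)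
  also have "\<dots> = (\<Sum>t<n. measure_pmf.expectation (star_coloring 3 n) (\<lambda>c. column_gain c t))"
    by (simp add: integrable_star_coloring)
  also have "\<dots> = (\<Sum>t<n. if t = 0 then 5 / 2
      else 7 / 8 + 3 / 224 * (1 - (1 / 8) ^ (t - 1)) - 1 / 1920 * (1 - (1 / 16) ^ (t - 1)))"
    by (intro sum.cong refl expectation_column_gain) simp
  also have "\<dots> = 2254219 / 1411200 + 6 / 49 * (1 / 8) ^ n - 2 / 225 * (1 / 16) ^ n + 11933 / 13440 * real n"
    \<comment> \<open>The closed form is indexed by \<open>Suc k\<close>, and
      \<open>n = Suc (n - 1)\<close> holds because \<open>n\<close> is positive.\<close>
    using sum_column_expectations[of "n - 1"] assms by simp
  also have "(1 / 8 :: real) ^ n = 2 powi (- 3 * int n)"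
    by (simp add: power_int_mult power_int_minus power_divide inverse_eq_divide)
  also have "(1 / 16 :: real) ^ n = 2 powi (- 4 * int n)"
    by (simp add: power_int_mult power_int_minus power_divide inverse_eq_divide)
  finally show ?thesis .
qed

end
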